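(* There exists an infinite family $\mathcal{F}$ of finite, simple, unweighted, geodetic graphs and a constant $c>0$ such that every $G=(V,E)\in\mathcal{F}$ satisfies $|E|\le c\,|V|$, and such that for every $G\in\mathcal{F}$ and every drawing $\varphi$ of $G$ in $\mathbb{R}^2$ there exist two shortest paths $P_1,P_2$ in $G$ for which the curves $\varphi(P_1)$ and $\varphi(P_2)$ meet at least four times.
   Context: A graph is geodetic if between every pair of vertices there is a unique shortest path (edges unweighted). A drawing $\varphi$ of a graph $G$ in $\mathbb{R}^2$ maps the vertices to pairwise distinct points and each edge to a Jordan arc between the images of its two end-vertices that is disjoint from the image of every other vertex. For a path $P=v_1,\dots,v_n$ in $G$, $\varphi(P)$ denotes the arc obtained by concatenating the curves $\varphi(v_1v_2),\dots,\varphi(v_{n-1}v_n)$. For two curves $\gamma_1,\gamma_2:[0,1]\to\mathbb{R}^2$, a meet is a pair of maximal intervals $I_1,I_2\subseteq[0,1]$ together with a bijection $\iota:I_1\to I_2$ such that $\gamma_1(x)=\gamma_2(\iota(x))$ for all $x\in I_1$; the curves meet $k$ times if they have $k$ pairwise distinct meets. *)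

theory Defs
  imports "HOL-Analysis.Analysis"
begin

type_synonym 'a ugraph = "'a set \<times> 'a set set"

abbreviation verts :: "'a ugraph \<Rightarrow> 'a set" where "verts G \<equiv> fst G"
abbreviation edges :: "'a ugraph \<Rightarrow> 'a set set" where "edges G \<equiv> snd G"

definition finite_simple_graph :: "'a ugraph \<Rightarrow> bool" where
  "finite_simple_graph G \<longleftrightarrow>
     finite (verts G) \<and> (\<forall>e\<in>edges G. e \<subseteq> verts G \<and> card e = 2)"

definition graph_iso :: "'a ugraph \<Rightarrow> 'b ugraph \<Rightarrow> bool" where
  "graph_iso G H \<longleftrightarrow>
     (\<exists>f. bij_betw f (verts G) (verts H) \<and> edges H = (\<lambda>e. f ` e) ` edges G)"

definition graph_path :: "'a ugraph \<Rightarrow> 'a \<Rightarrow> 'a \<Rightarrow> 'a list \<Rightarrow> bool" where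
  "graph_path G u v P \<longleftrightarrow>
     P \<noteq> [] \<and> hd P = u \<and> last P = v \<and> set P \<subseteq> verts G \<and> distinct P \<and>
     successively (\<lambda>x y. {x, y} \<in> edges G) P"

definition shortest_path :: "'a ugraph \<Rightarrow> 'a \<Rightarrow> 'a \<Rightarrow> 'a list \<Rightarrow> bool" where
  "shortest_path G u v P \<longleftrightarrow>
     graph_path G u v P \<and> (\<forall>Q. graph_path G u v Q \<longrightarrow> length P \<le> length Q)"

definition geodetic :: "'a ugraph \<Rightarrow> bool" where
  "geodetic G \<longleftrightarrow> (\<forall>u\<in>verts G. \<forall>v\<in>verts G. \<exists>!P. shortest_path G u v P)"

text \<open>
  A drawing is given by the vertex positions \<open>pos\<close> and a curve \<open>crv u v\<close> for each orientation
  of an edge; the two orientations of an edge are the same Jordan arc traversed in opposite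
  directions. Curves of different edges may intersect or overlap arbitrarily.
\<close>

definition drawing ::
    "'a ugraph \<Rightarrow> ('a \<Rightarrow> real^2) \<Rightarrow> ('a \<Rightarrow> 'a \<Rightarrow> real \<Rightarrow> real^2) \<Rightarrow> bool" where
  "drawing G pos crv \<longleftrightarrow>
     inj_on pos (verts G) \<and>
     (\<forall>u v. {u, v} \<in> edges G \<longrightarrow>
        arc (crv u v) \<and> pathstart (crv u v) = pos u \<and> pathfinish (crv u v) = pos v \<and>
        crv v u = reversepath (crv u v) \<and>
        (\<forall>w \<in> verts G - {u, v}. pos w \<notin> path_image (crv u v)))"

text \<open>Only meaningful for paths with at least one edge.\<close>

fun path_curve :: "('a \<Rightarrow> 'a \<Rightarrow> real \<Rightarrow> real^2) \<Rightarrow> 'a list \<Rightarrow> real \<Rightarrow> real^2" where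
  "path_curve crv (u # v # P) =
     (if P = [] then crv u v else crv u v +++ path_curve crv (v # P))"

text \<open>Without the nonemptiness requirement, two disjoint curves would have an empty meet.\<close>

definition common_part ::
    "(real \<Rightarrow> 'b) \<Rightarrow> (real \<Rightarrow> 'b) \<Rightarrow> real set \<Rightarrow> real set \<Rightarrow> (real \<Rightarrow> real) \<Rightarrow> bool" where
  "common_part \<gamma>1 \<gamma>2 I1 I2 \<iota> \<longleftrightarrow>
     is_interval I1 \<and> is_interval I2 \<and> I1 \<noteq> {} \<and> I2 \<noteq> {} \<and> I1 \<subseteq> {0..1} \<and> I2 \<subseteq> {0..1} \<and>
     bij_betw \<iota> I1 I2 \<and> (\<forall>x\<in>I1. \<gamma>1 x = \<gamma>2 (\<iota> x))"

definition is_meet ::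
    "(real \<Rightarrow> 'b) \<Rightarrow> (real \<Rightarrow> 'b) \<Rightarrow> real set \<Rightarrow> real set \<Rightarrow> (real \<Rightarrow> real) \<Rightarrow> bool" where
  "is_meet \<gamma>1 \<gamma>2 I1 I2 \<iota> \<longleftrightarrow>
     common_part \<gamma>1 \<gamma>2 I1 I2 \<iota> \<and>
     (\<forall>J1 J2 \<kappa>. common_part \<gamma>1 \<gamma>2 J1 J2 \<kappa> \<and> I1 \<subseteq> J1 \<and> I2 \<subseteq> J2 \<longrightarrow> J1 = I1 \<and> J2 = I2)"

text \<open>
  Meets are distinguished by their pair of intervals: on a self-intersecting stretch the same
  two intervals can admit several bijections, and these are not counted separately.
\<close>

definition meet_at_least :: "nat \<Rightarrow> (real \<Rightarrow> 'b) \<Rightarrow> (real \<Rightarrow> 'b) \<Rightarrow> bool" where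
  "meet_at_least k \<gamma>1 \<gamma>2 \<longleftrightarrow>
     (\<exists>S. finite S \<and> card S = k \<and> (\<forall>(I1, I2)\<in>S. \<exists>\<iota>. is_meet \<gamma>1 \<gamma>2 I1 I2 \<iota>))"

end

theory Submission
  imports Defs "HOL-Library.Nat_Bijection" "HOL-Library.Ramsey"
begin

text \<open>
  Take the complete graph on \<open>n\<close> vertices, \<open>n\<close> large, and subdivide every edge twice. The result is
  sparse and geodetic, and a geodesic may run from \<open>2/3\<close> of an edge \<open>ac\<close> back to \<open>a\<close> and then
  cover \<open>2/3\<close> of another edge \<open>ac'\<close>.

  In every drawing, among any five vertices there are two independent edges that meet: if two curves
  \<open>\<gamma>\<close>, \<open>\<delta>\<close> are disjoint, then \<open>\<gamma> s - \<delta> t\<close> has a continuous logarithm on the unit square, and summing the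
  resulting relations between the changes of argument over all 15 pairs of independent edges of the
  complete graph on five vertices equates an even number with an odd one.

  Colour each 4-set of vertices by an order pattern for which two such partial edges meet. On a
  homogeneous set, doubling two of the four slots of the pattern gives distinct vertices
  \<open>a, c, c', b, d, d'\<close> such that each of \<open>ac\<close>, \<open>ac'\<close> meets each of \<open>bd\<close>, \<open>bd'\<close>. The geodesics
  \<open>c a c'\<close> and \<open>d b d'\<close> then meet four times, since \<open>a\<close> does not lie on the second curve nor \<open>b\<close> on the
  first, so no meet extends across them.
\<close>

subsection \<open>Uniqueness of shortest paths\<close>

lemma graph_path_Cons_iff:
  "graph_path G u v (x # y # P) \<longleftrightarrow>
     x = u \<and> u \<in> verts G \<and> u \<notin> set (y # P) \<and> {u, y} \<in> edges G \<and> graph_path G y v (y # P)"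
  by (auto simp: graph_path_def)

text \<open>Local conditions that force \<open>d\<close> to be the distance to \<open>v\<close> and
  the shortest path to \<open>v\<close> to be unique. Geodeticity then reduces to a case analysis of
  a closed formula for \<open>d\<close>.\<close>

locale unique_descent =
  fixes G :: "'a ugraph" and v :: 'a and d :: "'a \<Rightarrow> nat"
  assumes target: "v \<in> verts G" and d_target: "d v = 0"
    and unique_step: "\<And>x. x \<in> verts G \<Longrightarrow> x \<noteq> v \<Longrightarrow>
      \<exists>!z. z \<in> verts G \<and> {x, z} \<in> edges G \<and> Suc (d z) = d x"
    and d_edge: "\<And>x z. {x, z} \<in> edges G \<Longrightarrow> d x \<le> Suc (d z)"
begin

text \<open>Along each edge \<open>d\<close> drops by at most one, and it has to reach 0. The
  \<open>Suc\<close> is there because \<open>length\<close> counts vertices.\<close>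

lemma length_ge: "graph_path G u v P \<Longrightarrow> Suc (d u) \<le> length P"
proof (induction P arbitrary: u)
  case Nil
  then show ?case by (simp add: graph_path_def)
next
  case (Cons x P)
  show ?case
  proof (cases P)
    case Nil
    with Cons.prems show ?thesis using d_target by (auto simp: graph_path_def)
  next
    case (Cons y Q)
    then have "{u, y} \<in> edges G" "graph_path G y v P"
      using Cons.prems by (simp_all add: graph_path_Cons_iff)
    then show ?thesis using Cons.IH[of y] d_edge[of u y] by simp
  qed
qed

text \<open>Descend step by step until \<open>v\<close> is reached. The bound on \<open>d\<close> is
  carried through the induction for the sake of distinctness: all later vertices have a smaller
  value than \<open>u\<close>, so \<open>u\<close> does not recur.\<close>

lemma descending_path_exists:
  "u \<in> verts G \<Longrightarrow> \<exists>P. graph_path G u v P \<and> length P = Suc (d u) \<and> (\<forall>x\<in>set P. d x \<le> d u)"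
proof (induction "d u" arbitrary: u rule: less_induct)
  case less
  show ?case
  proof (cases "u = v")
    case True
    then show ?thesis
      using target by (intro exI[of _ "[v]"]) (simp add: graph_path_def d_target)
  next
    case False
    then obtain z where z: "z \<in> verts G" "{u, z} \<in> edges G" "Suc (d z) = d u"
      using unique_step less.prems by blast
    then obtain P where P: "graph_path G z v P" "length P = Suc (d z)" "\<forall>x\<in>set P. d x \<le> d z"
      using less.hyps[of z] by auto
    then obtain Q where Q: "P = z # Q"
      by (cases P) (auto simp: graph_path_def)
    have "graph_path G u v (u # P)"
      using P z less.prems unfolding Q graph_path_Cons_iff by auto
    then show ?thesis using P z by (intro exI[of _ "u # P"]) auto
  qed
qed

text \<open>A path of this length has no slack: \<open>length_ge\<close> for its tail and
  \<open>d_edge\<close> for its first edge force a drop of exactly one, so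
  \<open>unique_step\<close> determines each next vertex.\<close>

lemma tight_path_unique:
  "graph_path G u v P \<Longrightarrow> graph_path G u v Q \<Longrightarrow> length P = Suc (d u) \<Longrightarrow> length Q = Suc (d u) \<Longrightarrow> P = Q"
proof (induction P arbitrary: u Q)
  case Nil
  then show ?case by simp
next
  case (Cons x P)
  have u: "x = u" "u \<in> verts G" using Cons.prems by (auto simp: graph_path_def)
  obtain Q' where Q: "Q = u # Q'" using Cons.prems by (cases Q) (auto simp: graph_path_def)
  show ?case
  proof (cases P)
    case Nil
    with Cons.prems Q u show ?thesis by simp
  next
    case (Cons y P')
    with Cons.prems Q obtain z Q'' where Q': "Q' = z # Q''" by (cases Q') auto
    have y: "y \<in> verts G" "{u, y} \<in> edges G" "graph_path G y v P" "u \<notin> set P"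
      using Cons.prems(1) Cons by (auto simp: graph_path_def)
    have z: "z \<in> verts G" "{u, z} \<in> edges G" "graph_path G z v Q'"
      using Cons.prems(2) Q Q' by (auto simp: graph_path_def)
    have dy: "Suc (d y) = d u"
      using length_ge[OF y(3)] d_edge[OF y(2)] Cons.prems(3) by simp
    have dz: "Suc (d z) = d u"
      using length_ge[OF z(3)] d_edge[OF z(2)] Cons.prems(4) Q by simp
    have "u \<noteq> v" using dy d_target by auto
    then have "z = y" using unique_step[OF u(2)] y z dy dz by blast
    then have "P = Q'"
      using Cons.IH[of y Q'] y z Cons.prems(3,4) dy Q by simp
    then show ?thesis using Q u by simp
  qed
qed

lemma shortest_path_iff:
  assumes "u \<in> verts G"
  shows "shortest_path G u v P \<longleftrightarrow> graph_path G u v P \<and> length P = Suc (d u)"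
proof -
  obtain P0 where "graph_path G u v P0" "length P0 = Suc (d u)"
    using descending_path_exists[OF assms] by blast
  then show ?thesis unfolding shortest_path_def
    by (metis length_ge le_antisym)
qed

lemma ex1_shortest_path:
  assumes "u \<in> verts G"
  shows "\<exists>!P. shortest_path G u v P"
  unfolding shortest_path_iff[OF assms]
  using descending_path_exists[OF assms] tight_path_unique by blast

end

subsection \<open>The complete graph with every edge subdivided twice\<close>

text \<open>
  The pair \<open>(a, a)\<close> stands for the vertex \<open>a\<close> of the complete graph, and \<open>(a, b)\<close> for the
  subdivision vertex next to \<open>a\<close> on the edge \<open>ab\<close>.
\<close>

definition sub_verts :: "nat \<Rightarrow> nat set" where
  "sub_verts n = prod_encode ` ({..<n} \<times> {..<n})"

definition sub_edges :: "nat \<Rightarrow> nat set set" where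
  "sub_edges n =
     {{prod_encode (a, a), prod_encode (a, b)} | a b. a < n \<and> b < n \<and> a \<noteq> b} \<union>
     {{prod_encode (a, b), prod_encode (b, a)} | a b. a < n \<and> b < n \<and> a \<noteq> b}"

definition sub_complete :: "nat \<Rightarrow> nat ugraph" where
  "sub_complete n = (sub_verts n, sub_edges n)"

lemma prod_encode_in_sub_verts [simp]:
  "prod_encode (a, b) \<in> sub_verts n \<longleftrightarrow> a < n \<and> b < n"
  by (auto simp: sub_verts_def)

lemma sub_edge_iff [simp]:
  "{prod_encode (a, b), prod_encode (c, e)} \<in> sub_edges n \<longleftrightarrow>
     a < n \<and> b < n \<and> c < n \<and> e < n \<and>
     (a = c \<and> b \<noteq> e \<and> (a = b \<or> c = e) \<or> a \<noteq> b \<and> c = b \<and> e = a)"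
  by (auto simp: sub_edges_def doubleton_eq_iff)

lemma verts_sub_complete [simp]: "verts (sub_complete n) = sub_verts n"
  and edges_sub_complete [simp]: "edges (sub_complete n) = sub_edges n"
  by (simp_all add: sub_complete_def)

lemma card_sub_verts: "card (sub_verts n) = n * n"
  by (simp add: sub_verts_def card_image inj_on_def)

lemma finite_simple_graph_sub_complete: "finite_simple_graph (sub_complete n)"
proof -
  have "e \<subseteq> sub_verts n \<and> card e = 2" if "e \<in> sub_edges n" for e
    using that by (auto simp: sub_edges_def card_insert_if)
  then show ?thesis
    by (simp add: finite_simple_graph_def) (simp add: sub_verts_def)
qed

lemma card_sub_edges_le: "card (sub_edges n) \<le> 2 * (n * n)"
proof -
  let ?S = "{..<n} \<times> {..<n}"
  let ?f = "\<lambda>(a, b). {prod_encode (a, a), prod_encode (a, b)}"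
  let ?g = "\<lambda>(a, b). {prod_encode (a, b), prod_encode (b, a)}"
  have "sub_edges n \<subseteq> ?f ` ?S \<union> ?g ` ?S"
    by (auto simp: sub_edges_def image_iff)
  then have "card (sub_edges n) \<le> card (?f ` ?S \<union> ?g ` ?S)"
    by (intro card_mono) auto
  also have "\<dots> \<le> card (?f ` ?S) + card (?g ` ?S)"
    by (rule card_Un_le)
  also have "\<dots> \<le> card ?S + card ?S"
    by (intro add_mono card_image_le) auto
  finally show ?thesis by simp
qed

lemma graph_iso_sub_complete:
  assumes "graph_iso (sub_complete m) (sub_complete n)"
  shows "m = n"
proof -
  obtain f where "bij_betw f (sub_verts m) (sub_verts n)"
    using assms by (auto simp: graph_iso_def)
  then have "m * m = n * n"
    by (metis bij_betw_same_card card_sub_verts)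
  then show ?thesis
    by (metis power2_eq_square power2_eq_iff_nonneg zero_le)
qed

text \<open>The distance between \<open>(a, b)\<close> and \<open>(a, c)\<close> inside the star of
  \<open>a\<close>, whose centre is \<open>(a, a)\<close> and whose leaves are the subdivision
  vertices next to \<open>a\<close>.\<close>

definition star_dist :: "nat \<Rightarrow> nat \<Rightarrow> nat \<Rightarrow> nat" where
  "star_dist a b c = (if b = c then 0 else if a = b \<or> a = c then 1 else 2)"

text \<open>
  The value 4 is the detour through the star of the common second entry \<open>b = e\<close>, which beats the
  path of length 5 along the edge \<open>ac\<close>.
\<close>

fun sub_dist :: "nat \<times> nat \<Rightarrow> nat \<times> nat \<Rightarrow> nat" where
  "sub_dist (a, b) (c, e) =
     (if a = c then star_dist a b e
      else if b = e \<and> b \<noteq> a \<and> b \<noteq> c then 4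
      else star_dist a b c + 1 + star_dist c a e)"

lemma sub_dist_edge:
  assumes "{prod_encode (a, b), prod_encode (a', b')} \<in> sub_edges n"
  shows "sub_dist (a, b) (c, e) \<le> Suc (sub_dist (a', b') (c, e))"
proof -
  consider "a' = a" "b = a" "b' \<noteq> a" | "a' = a" "b' = a" "b \<noteq> a" | "a' = b" "b' = a" "a \<noteq> b"
    using assms by auto
  then show ?thesis
    by cases (simp_all add: star_dist_def)
qed

lemma sub_dist_unique_step:
  assumes "a < n" "b < n" "c < n" "e < n" "(a, b) \<noteq> (c, e)"
  shows "\<exists>!z. z \<in> {..<n} \<times> {..<n} \<and> {prod_encode (a, b), prod_encode z} \<in> sub_edges n \<and>
      Suc (sub_dist z (c, e)) = sub_dist (a, b) (c, e)"
proof -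
  \<comment> \<open>The next vertex towards \<open>(c, e)\<close>. From a centre it is the leaf
    facing the target. From a leaf outside the star of \<open>c\<close> it is the other end of the
    middle edge, if that edge leads into the star of \<open>c\<close> or starts the detour of length
    4. In all other cases it is the centre.\<close>
  let ?z = "if a = b then (a, if a = c then e else c)
            else if a = c then (a, a)
            else if b = c then (b, a)
            else if b = e then (b, a) else (a, a)"
  show ?thesis
  proof (rule ex1I[of _ ?z])
    show "?z \<in> {..<n} \<times> {..<n} \<and> {prod_encode (a, b), prod_encode ?z} \<in> sub_edges n \<and>
        Suc (sub_dist ?z (c, e)) = sub_dist (a, b) (c, e)"
      using assms by (auto simp: star_dist_def)
  next
    fix z assume "z \<in> {..<n} \<times> {..<n} \<and> {prod_encode (a, b), prod_encode z} \<in> sub_edges n \<and>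
        Suc (sub_dist z (c, e)) = sub_dist (a, b) (c, e)"
    then obtain a' b' where z: "z = (a', b')"
      and "{prod_encode (a, b), prod_encode (a', b')} \<in> sub_edges n"
      and step: "Suc (sub_dist (a', b') (c, e)) = sub_dist (a, b) (c, e)"
      by (cases z) auto
    then consider "a' = a" "b = a" "b' \<noteq> a" | "a' = a" "b' = a" "b \<noteq> a" | "a' = b" "b' = a" "a \<noteq> b"
      by auto
    then show "z = ?z"
      using step assms(5) unfolding z
      by cases (simp_all add: star_dist_def split: if_splits)
  qed
qed

lemma unique_descent_sub_complete:
  assumes "c < n" "e < n"
  shows "unique_descent (sub_complete n) (prod_encode (c, e)) (\<lambda>x. sub_dist (prod_decode x) (c, e))"
proof
  fix x assume x: "x \<in> verts (sub_complete n)" "x \<noteq> prod_encode (c, e)"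
  then obtain a b where ab: "x = prod_encode (a, b)" "a < n" "b < n"
    by (auto simp: sub_verts_def)
  obtain z where z: "z \<in> {..<n} \<times> {..<n}" "{x, prod_encode z} \<in> sub_edges n"
      "Suc (sub_dist z (c, e)) = sub_dist (a, b) (c, e)"
    and uniq: "\<And>y. y \<in> {..<n} \<times> {..<n} \<Longrightarrow> {x, prod_encode y} \<in> sub_edges n \<Longrightarrow>
      Suc (sub_dist y (c, e)) = sub_dist (a, b) (c, e) \<Longrightarrow> y = z"
    using sub_dist_unique_step[of a n b c e] ab x assms by (metis (no_types, lifting))
  show "\<exists>!z. z \<in> verts (sub_complete n) \<and> {x, z} \<in> edges (sub_complete n) \<and>
      Suc (sub_dist (prod_decode z) (c, e)) = sub_dist (prod_decode x) (c, e)"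
  proof (rule ex1I[of _ "prod_encode z"])
    show "prod_encode z \<in> verts (sub_complete n) \<and> {x, prod_encode z} \<in> edges (sub_complete n) \<and>
      Suc (sub_dist (prod_decode (prod_encode z)) (c, e)) = sub_dist (prod_decode x) (c, e)"
      using z ab by (simp add: sub_verts_def)
  next
    fix y assume y: "y \<in> verts (sub_complete n) \<and> {x, y} \<in> edges (sub_complete n) \<and>
      Suc (sub_dist (prod_decode y) (c, e)) = sub_dist (prod_decode x) (c, e)"
    then obtain w where "y = prod_encode w" "w \<in> {..<n} \<times> {..<n}"
      by (auto simp: sub_verts_def)
    then show "y = prod_encode z" using y ab uniq[of w] by simp
  qed
next
  fix x z assume "{x, z} \<in> edges (sub_complete n)"
  then show "sub_dist (prod_decode x) (c, e) \<le> Suc (sub_dist (prod_decode z) (c, e))"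
    using sub_dist_edge[of "fst (prod_decode x)" "snd (prod_decode x)" "fst (prod_decode z)"
        "snd (prod_decode z)" n c e]
    by simp
qed (use assms in \<open>simp_all add: star_dist_def\<close>)

lemma geodetic_sub_complete: "geodetic (sub_complete n)"
  unfolding geodetic_def
proof (intro ballI)
  fix u v assume "u \<in> verts (sub_complete n)" "v \<in> verts (sub_complete n)"
  moreover from this obtain c e where "v = prod_encode (c, e)" "c < n" "e < n"
    by (auto simp: sub_verts_def)
  ultimately show "\<exists>!P. shortest_path (sub_complete n) u v P"
    using unique_descent.ex1_shortest_path[OF unique_descent_sub_complete] by simp
qed

definition star_path :: "nat \<Rightarrow> nat \<Rightarrow> nat \<Rightarrow> nat list" where
  "star_path a c c' = map prod_encode [(c, a), (a, c), (a, a), (a, c'), (c', a)]"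

text \<open>Both ends have second entry \<open>a\<close>, which is the case of value 4 in
  \<open>sub_dist\<close>; the four edges of the path attain it.\<close>

lemma shortest_path_star_path:
  assumes "a < n" "c < n" "c' < n" "distinct [a, c, c']"
  shows "shortest_path (sub_complete n) (prod_encode (c, a)) (prod_encode (c', a)) (star_path a c c')"
  using assms
  by (subst unique_descent.shortest_path_iff[OF unique_descent_sub_complete])
    (auto simp: star_path_def graph_path_def star_dist_def)

subsection \<open>Independent edges in drawings of the complete graph on five vertices\<close>

text \<open>The increment along \<gamma> of a continuous logarithm of \<open>\<gamma> t - z\<close>;
  its imaginary part is the change of argument as seen from \<open>z\<close>. The value carries
  information only if such a logarithm exists, and then the choice does not matter, by the next
  lemma.\<close>

definition log_change :: "(real \<Rightarrow> complex) \<Rightarrow> complex \<Rightarrow> complex" where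
  "log_change \<gamma> z = (SOME L. \<exists>g. continuous_on {0..1} g \<and>
     (\<forall>t\<in>{0..1}. exp (g t) = \<gamma> t - z) \<and> L = g 1 - g 0)"

text \<open>The difference of two logarithms is continuous and takes values in the multiples of
  \<open>2 * pi * \<i>\<close>. Distinct values are at least \<open>2 * pi\<close> apart, so it is
  constant.\<close>

lemma continuous_logs_differ_by_constant:
  fixes g h :: "real \<Rightarrow> complex"
  assumes "continuous_on {0..1} g" "continuous_on {0..1} h"
    and "\<And>t. t \<in> {0..1} \<Longrightarrow> exp (g t) = exp (h t)"
  shows "g 1 - g 0 = h 1 - h 0"
proof -
  have "(\<lambda>t. g t - h t) constant_on {0..1}"
  proof (rule continuous_discrete_range_constant)
    show "continuous_on {0..1} (\<lambda>t. g t - h t)"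
      by (intro continuous_intros assms)
    fix x :: real assume x: "x \<in> {0..1}"
    have "2 * pi \<le> norm ((g y - h y) - (g x - h x))"
      if y: "y \<in> {0..1}" "g y - h y \<noteq> g x - h x" for y
    proof -
      obtain m :: int where m: "g y = h y + of_int (2 * m) * pi * \<i>"
        using assms(3)[OF y(1)] unfolding exp_eq by blast
      obtain n :: int where n: "g x = h x + of_int (2 * n) * pi * \<i>"
        using assms(3)[OF x] unfolding exp_eq by blast
      have "m \<noteq> n" using y m n by auto
      then have "1 \<le> \<bar>real_of_int (m - n)\<bar>"
        by linarith
      moreover have "(g y - h y) - (g x - h x) = of_real (2 * pi * of_int (m - n)) * \<i>"
        using m n by (simp add: algebra_simps)
      then have "norm ((g y - h y) - (g x - h x)) = 2 * pi * \<bar>real_of_int (m - n)\<bar>"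
        by (simp only: norm_mult norm_of_real norm_ii) (simp add: abs_mult)
      ultimately show ?thesis by simp
    qed
    then show "\<exists>e>0. \<forall>y. y \<in> {0..1} \<and> g y - h y \<noteq> g x - h x \<longrightarrow>
        e \<le> norm ((g y - h y) - (g x - h x))"
      by (intro exI[of _ "2 * pi"]) auto
  qed auto
  then obtain k where "\<And>t. t \<in> {0..1} \<Longrightarrow> g t - h t = k"
    by (auto simp: constant_on_def)
  from this[of 0] this[of 1] show ?thesis by (simp add: algebra_simps)
qed

lemma log_change_eq:
  assumes "continuous_on {0..1} g" "\<And>t. t \<in> {0..1} \<Longrightarrow> exp (g t) = \<gamma> t - z"
  shows "log_change \<gamma> z = g 1 - g 0"
  unfolding log_change_def
proof (rule some_equality)
  show "\<exists>g'. continuous_on {0..1} g' \<and> (\<forall>t\<in>{0..1}. exp (g' t) = \<gamma> t - z) \<and> g 1 - g 0 = g' 1 - g' 0"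
    using assms by blast
next
  fix L assume "\<exists>g. continuous_on {0..1} g \<and> (\<forall>t\<in>{0..1}. exp (g t) = \<gamma> t - z) \<and> L = g 1 - g 0"
  then show "L = g 1 - g 0"
    using continuous_logs_differ_by_constant assms by metis
qed

text \<open>The map \<open>\<gamma> s - \<delta> t\<close> has no zero on the unit square, which is
  contractible, so it has a continuous logarithm \<open>g\<close> there. The four changes are
  increments of \<open>g\<close> along the sides of the square, and both ways around from one corner
  to the opposite one give the same total.\<close>

lemma log_change_disjoint_paths:
  assumes "path \<gamma>" "path \<delta>" and disj: "path_image \<gamma> \<inter> path_image \<delta> = {}"
  shows "log_change \<gamma> (pathstart \<delta>) + log_change \<delta> (pathfinish \<gamma>) =
         log_change \<delta> (pathstart \<gamma>) + log_change \<gamma> (pathfinish \<delta>)"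
    and "exp (log_change \<gamma> (pathstart \<delta>)) =
         (pathfinish \<gamma> - pathstart \<delta>) / (pathstart \<gamma> - pathstart \<delta>)"
    and "exp (log_change \<gamma> (pathfinish \<delta>)) =
         (pathfinish \<gamma> - pathfinish \<delta>) / (pathstart \<gamma> - pathfinish \<delta>)"
proof -
  let ?Q = "{0..1} \<times> {0..1} :: (real \<times> real) set"
  have \<gamma>: "continuous_on {0..1} \<gamma>" and \<delta>: "continuous_on {0..1} \<delta>"
    using assms by (simp_all add: path_def)
  have cont: "continuous_on ?Q (\<lambda>p. \<gamma> (fst p) - \<delta> (snd p))"
    by (intro continuous_intros continuous_on_compose2[OF \<gamma>] continuous_on_compose2[OF \<delta>]) auto
  have nz: "\<gamma> (fst p) - \<delta> (snd p) \<noteq> 0" if "p \<in> ?Q" for p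
    using that disj by (auto simp: path_image_def)
  have "contractible ?Q"
    by (intro convex_imp_contractible convex_Times) auto
  then obtain g where g: "continuous_on ?Q g"
      and exp_g: "\<And>p. p \<in> ?Q \<Longrightarrow> \<gamma> (fst p) - \<delta> (snd p) = exp (g p)"
    using continuous_logarithm_on_contractible[OF cont _ nz] by blast
  have row: "log_change \<gamma> (\<delta> t) = g (1, t) - g (0, t)" if "t \<in> {0..1}" for t
    by (rule log_change_eq, rule continuous_on_compose2[OF g])
      (use that exp_g in \<open>auto intro!: continuous_intros\<close>)
  have col: "log_change \<delta> (\<gamma> s) = g (s, 1) - g (s, 0)" if "s \<in> {0..1}" for s
  proof -
    \<comment> \<open>Adding \<open>\<i> * pi\<close> turns a logarithm of
      \<open>\<gamma> s - \<delta> t\<close> into one of \<open>\<delta> t - \<gamma> s\<close>; the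
      shift cancels in the increment.\<close>
    have "log_change \<delta> (\<gamma> s) = (g (s, 1) + \<i> * pi) - (g (s, 0) + \<i> * pi)"
    proof (rule log_change_eq)
      show "continuous_on {0..1} (\<lambda>t. g (s, t) + \<i> * pi)"
        by (intro continuous_intros continuous_on_compose2[OF g]) (use that in auto)
      show "exp (g (s, t) + \<i> * pi) = \<delta> t - \<gamma> s" if "t \<in> {0..1}" for t
        using exp_g[of "(s, t)"] \<open>s \<in> {0..1}\<close> that by (simp add: exp_add algebra_simps)
    qed
    then show ?thesis by simp
  qed
  show "log_change \<gamma> (pathstart \<delta>) + log_change \<delta> (pathfinish \<gamma>) =
         log_change \<delta> (pathstart \<gamma>) + log_change \<gamma> (pathfinish \<delta>)"
    using row[of 0] row[of 1] col[of 0] col[of 1] by (simp add: pathstart_def pathfinish_def)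
  show "exp (log_change \<gamma> (pathstart \<delta>)) =
         (pathfinish \<gamma> - pathstart \<delta>) / (pathstart \<gamma> - pathstart \<delta>)"
    using row[of 0] exp_g[of "(0,0)"] exp_g[of "(1,0)"]
    by (simp add: pathstart_def pathfinish_def exp_diff)
  show "exp (log_change \<gamma> (pathfinish \<delta>)) =
         (pathfinish \<gamma> - pathfinish \<delta>) / (pathstart \<gamma> - pathfinish \<delta>)"
    using row[of 1] exp_g[of "(0,1)"] exp_g[of "(1,1)"]
    by (simp add: pathstart_def pathfinish_def exp_diff)
qed

text \<open>Disjointness enters only through changes of argument, so the curves can be arbitrary
  continuous paths and no general position is required.\<close>

proposition K5_independent_edges_meet:
  fixes p :: "nat \<Rightarrow> complex" and \<gamma> :: "nat \<Rightarrow> nat \<Rightarrow> real \<Rightarrow> complex"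
  assumes edge: "\<And>i j. i < j \<Longrightarrow> j < 5 \<Longrightarrow>
      path (\<gamma> i j) \<and> pathstart (\<gamma> i j) = p i \<and> pathfinish (\<gamma> i j) = p j"
  shows "\<exists>i j k l. i < j \<and> j < 5 \<and> k < l \<and> l < 5 \<and> distinct [i, j, k, l] \<and>
      path_image (\<gamma> i j) \<inter> path_image (\<gamma> k l) \<noteq> {}"
proof (rule ccontr)
  assume "\<not> ?thesis"
  then have disj: "path_image (\<gamma> i j) \<inter> path_image (\<gamma> k l) = {}"
    if "i < j" "j < 5" "k < l" "l < 5" "distinct [i, j, k, l]" for i j k l
    using that by blast
  \<comment> \<open>Distinctness comes from the assumed disjointness: two further vertices
    \<open>j\<close> and \<open>l\<close> place \<open>p i\<close> and \<open>p k\<close> on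
    independent edges.\<close>
  have p_off: "p i \<noteq> p k" if "i < k" "k < 5" for i k
  proof -
    have "\<exists>j l. j < 5 \<and> l < 5 \<and> distinct [i, j, k, l]"
    proof -
      have "card ({..<5} - {i, k}) = 3"
        using that by (subst card_Diff_subset) auto
      then obtain j l m where "{..<5} - {i, k} = {j, l, m}" "j \<noteq> l"
        by (auto simp: card_3_iff)
      then have "j \<in> {..<5} - {i, k}" "l \<in> {..<5} - {i, k}" by auto
      then show ?thesis using \<open>j \<noteq> l\<close> that by (intro exI[of _ j] exI[of _ l]) auto
    qed
    then obtain j l where jl: "j < 5" "l < 5" "distinct [i, j, k, l]" by blast
    let ?a = "\<gamma> (min i j) (max i j)" and ?b = "\<gamma> (min k l) (max k l)"
    have "path_image ?a \<inter> path_image ?b = {}"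
      using jl that by (intro disj) (auto simp: min_def max_def)
    moreover have "p i \<in> path_image ?a"
      using edge[of "min i j" "max i j"] jl that pathstart_in_path_image[of ?a] pathfinish_in_path_image[of ?a]
      by (cases "i < j") (auto simp: min_def max_def)
    moreover have "p k \<in> path_image ?b"
      using edge[of "min k l" "max k l"] jl that pathstart_in_path_image[of ?b] pathfinish_in_path_image[of ?b]
      by (cases "k < l") (auto simp: min_def max_def)
    ultimately show ?thesis by auto
  qed
  \<comment> \<open>\<open>\<Theta> i k\<close> is a fixed logarithm of \<open>p i - p k\<close>; \<open>\<kappa>\<close> below counts full turns relative to it.\<close>
  define \<Theta> where "\<Theta> i k = (if i < k then Ln (p i - p k) else Ln (p k - p i) + \<i> * pi)" for i k
  have exp_\<Theta>: "exp (\<Theta> i k) = p i - p k" if "i \<noteq> k" "i < 5" "k < 5" for i k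
    using that p_off[of i k] p_off[of k i] by (auto simp: \<Theta>_def exp_add)
  have \<Theta>_swap: "\<Theta> k i = \<Theta> i k + \<i> * pi" if "i < k" for i k
    using that by (simp add: \<Theta>_def)
  have "\<exists>m::int. log_change (\<gamma> i j) (p k) = \<Theta> j k - \<Theta> i k + 2 * pi * \<i> * m"
    if ij: "i < j" "j < 5" "k < 5" "k \<noteq> i" "k \<noteq> j" for i j k
  proof -
    have "card ({..<5} - {i, j, k}) = 2"
      using ij by (subst card_Diff_subset) auto
    then obtain l where "l \<in> {..<5} - {i, j, k}"
      by (metis card.empty equals0I zero_neq_numeral)
    then have l: "l < 5" "distinct [i, j, k, l]" using ij by auto
    \<comment> \<open>The edge joining \<open>k\<close> and \<open>l\<close> is independent of
      \<open>ij\<close>. Whether \<open>p k\<close> is its start or its finish decides which of the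
      two exponential formulas applies.\<close>
    have "exp (log_change (\<gamma> i j) (p k)) = (p j - p k) / (p i - p k)"
    proof (cases "k < l")
      case True
      then show ?thesis
        using log_change_disjoint_paths(2)[of "\<gamma> i j" "\<gamma> k l"] disj[of i j k l] edge[of i j] edge[of k l] ij l
        by auto
    next
      case False
      then show ?thesis
        using log_change_disjoint_paths(3)[of "\<gamma> i j" "\<gamma> l k"] disj[of i j l k] edge[of i j] edge[of l k] ij l
        by auto
    qed
    also have "\<dots> = exp (\<Theta> j k - \<Theta> i k)"
      using ij by (simp add: exp_diff exp_\<Theta>)
    finally obtain m :: int where "log_change (\<gamma> i j) (p k) = \<Theta> j k - \<Theta> i k + of_int (2 * m) * pi * \<i>"
      unfolding exp_eq by blast
    then show ?thesis by (intro exI[of _ m]) (simp add: algebra_simps)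
  qed
  then obtain \<kappa> :: "nat \<Rightarrow> nat \<Rightarrow> nat \<Rightarrow> int" where
    \<kappa>: "\<And>i j k. i < j \<Longrightarrow> j < 5 \<Longrightarrow> k < 5 \<Longrightarrow> k \<noteq> i \<Longrightarrow> k \<noteq> j \<Longrightarrow>
          log_change (\<gamma> i j) (p k) = \<Theta> j k - \<Theta> i k + 2 * pi * \<i> * \<kappa> i j k"
    by metis
  have cell: "log_change (\<gamma> i j) (p k) + log_change (\<gamma> k l) (p j) =
      log_change (\<gamma> k l) (p i) + log_change (\<gamma> i j) (p l)"
    if "i < j" "j < 5" "k < l" "l < 5" "distinct [i, j, k, l]" for i j k l
    using log_change_disjoint_paths(1)[of "\<gamma> i j" "\<gamma> k l"] disj[OF that] edge that by simp
  have int_eq: "m = n" if "2 * pi * \<i> * of_int m = 2 * pi * \<i> * of_int n" for m n :: int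
    using that by simp
  \<comment> \<open>Only the middle pairing, the crossing one for four points in convex position, is odd.\<close>
  have parity: "\<kappa> a b c + \<kappa> c d b = \<kappa> c d a + \<kappa> a b d"
       "\<kappa> a c b + \<kappa> b d c + 1 = \<kappa> b d a + \<kappa> a c d"
       "\<kappa> a d b + \<kappa> b c d = \<kappa> b c a + \<kappa> a d c"
    if "a < b" "b < c" "c < d" "d < 5" for a b c d
  proof -
    have "2 * pi * \<i> * of_int (\<kappa> a b c + \<kappa> c d b) = 2 * pi * \<i> * of_int (\<kappa> c d a + \<kappa> a b d)"
      using cell[of a b c d] that
      by (simp add: \<kappa> \<Theta>_swap[of a c] \<Theta>_swap[of a d] \<Theta>_swap[of b c] \<Theta>_swap[of b d] algebra_simps)
    then show "\<kappa> a b c + \<kappa> c d b = \<kappa> c d a + \<kappa> a b d" by (rule int_eq)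
    have "2 * pi * \<i> * of_int (\<kappa> a c b + \<kappa> b d c + 1) = 2 * pi * \<i> * of_int (\<kappa> b d a + \<kappa> a c d)"
      using cell[of a c b d] that
      by (simp add: \<kappa> \<Theta>_swap[of a b] \<Theta>_swap[of a d] \<Theta>_swap[of b c] \<Theta>_swap[of c d] algebra_simps)
    then show "\<kappa> a c b + \<kappa> b d c + 1 = \<kappa> b d a + \<kappa> a c d" by (rule int_eq)
    have "2 * pi * \<i> * of_int (\<kappa> a d b + \<kappa> b c d) = 2 * pi * \<i> * of_int (\<kappa> b c a + \<kappa> a d c)"
      using cell[of a d b c] that
      by (simp add: \<kappa> \<Theta>_swap[of a b] \<Theta>_swap[of a c] \<Theta>_swap[of b d] \<Theta>_swap[of c d] algebra_simps)
    then show "\<kappa> a d b + \<kappa> b c d = \<kappa> b c a + \<kappa> a d c" by (rule int_eq)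
  qed
  \<comment> \<open>The sum of all 15 relations. For an edge \<open>ij\<close> and a vertex
    \<open>k\<close> off it, the term \<open>\<kappa> i j k\<close> occurs in exactly two of them,
    one for each choice of the other end of an independent edge at \<open>k\<close>. So its total
    coefficient is 2, -2 or 0, while each of the five 4-sets contributes a single 1.\<close>
  have "2 * (\<kappa> 0 1 2 + \<kappa> 0 2 1 + \<kappa> 1 3 2 + \<kappa> 0 3 1 + \<kappa> 1 2 3 + \<kappa> 1 4 2 + \<kappa> 0 4 1 + \<kappa> 3 4 2
      + \<kappa> 2 4 3 + \<kappa> 2 3 4 - \<kappa> 2 3 0 - \<kappa> 1 3 0 - \<kappa> 1 2 0 - \<kappa> 2 4 0 - \<kappa> 0 1 4 - \<kappa> 1 4 0
      - \<kappa> 0 2 4 - \<kappa> 3 4 0 - \<kappa> 0 3 4 - \<kappa> 0 4 3) + 5 = 0"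
    using parity[of 0 1 2 3] parity[of 0 1 2 4] parity[of 0 1 3 4] parity[of 0 2 3 4] parity[of 1 2 3 4]
    by simp
  then show False by presburger
qed

subsection \<open>Meets of curves\<close>

text \<open>Such a bijection restricts to the fibres, and conversely bijections between fibres glue.
  This replaces the map in a common part by a counting condition on the two intervals.\<close>

lemma ex_bij_betw_over_iff:
  assumes "\<And>p. finite {x \<in> A. f x = p}" "\<And>p. finite {y \<in> B. g y = p}"
  shows "(\<exists>\<iota>. bij_betw \<iota> A B \<and> (\<forall>x\<in>A. f x = g (\<iota> x))) \<longleftrightarrow>
         (\<forall>p. card {x \<in> A. f x = p} = card {y \<in> B. g y = p})"
proof safe
  fix \<iota> p assume \<iota>: "bij_betw \<iota> A B" "\<forall>x\<in>A. f x = g (\<iota> x)"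
  have "bij_betw \<iota> {x \<in> A. f x = p} {y \<in> B. g y = p}"
    using \<iota> by (auto simp: bij_betw_def inj_on_def)
  then show "card {x \<in> A. f x = p} = card {y \<in> B. g y = p}"
    by (rule bij_betw_same_card)
next
  assume "\<forall>p. card {x \<in> A. f x = p} = card {y \<in> B. g y = p}"
  then have "\<forall>p. \<exists>h. bij_betw h {x \<in> A. f x = p} {y \<in> B. g y = p}"
    using assms finite_same_card_bij by blast
  then obtain h where h: "\<And>p. bij_betw (h p) {x \<in> A. f x = p} {y \<in> B. g y = p}"
    by metis
  have in_B: "h (f x) x \<in> B" "g (h (f x) x) = f x" if "x \<in> A" for x
    using bij_betwE[OF h[of "f x"]] that by auto
  have "bij_betw (\<lambda>x. h (f x) x) A B"
  proof (rule bij_betwI')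
    fix x x' assume x: "x \<in> A" "x' \<in> A"
    show "h (f x) x = h (f x') x' \<longleftrightarrow> x = x'"
    proof
      assume eq: "h (f x) x = h (f x') x'"
      then have "f x = f x'" using in_B x by metis
      then show "x = x'" using eq x bij_betw_imp_inj_on[OF h[of "f x'"]] by (auto simp: inj_on_def)
    qed auto
  next
    fix y assume "y \<in> B"
    then have "y \<in> h (g y) ` {x \<in> A. f x = g y}"
      using bij_betw_imp_surj_on[OF h[of "g y"]] by auto
    then obtain x where "x \<in> A" "f x = g y" "y = h (g y) x" by blast
    then show "\<exists>x\<in>A. y = h (f x) x" by (intro bexI[of _ x]) simp_all
  qed (use in_B in auto)
  then show "\<exists>\<iota>. bij_betw \<iota> A B \<and> (\<forall>x\<in>A. f x = g (\<iota> x))"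
    using in_B by (intro exI[of _ "\<lambda>x. h (f x) x"]) auto
qed

text \<open>
  Two intervals form a common part iff every point has equally many preimages in both. With finite
  fibres this survives unions of chains, so Zorn's lemma yields maximal common parts.
\<close>

lemma meet_through_common_point:
  assumes fin1: "\<And>p. finite {t \<in> {0..1}. \<gamma>1 t = p}" and fin2: "\<And>p. finite {t \<in> {0..1}. \<gamma>2 t = p}"
    and xy: "x \<in> {0..1}" "y \<in> {0..1}" "\<gamma>1 x = \<gamma>2 y"
  obtains I1 I2 \<iota> where "is_meet \<gamma>1 \<gamma>2 I1 I2 \<iota>" "x \<in> I1" "y \<in> I2"
proof -
  define fib1 where "fib1 I p = {t \<in> I. \<gamma>1 t = p}" for I p
  define fib2 where "fib2 I p = {t \<in> I. \<gamma>2 t = p}" for I p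
  \<comment> \<open>Any larger pair of intervals still contains \<open>x\<close> and
    \<open>y\<close>, so maximality within \<open>cp\<close> is maximality in the sense of
    \<open>is_meet\<close>.\<close>
  define cp where "cp I1 I2 \<longleftrightarrow> (\<exists>\<iota>. common_part \<gamma>1 \<gamma>2 I1 I2 \<iota>) \<and> x \<in> I1 \<and> y \<in> I2" for I1 I2
  have fin1': "finite (fib1 I p)" if "I \<subseteq> {0..1}" for I p
    unfolding fib1_def by (rule finite_subset[OF _ fin1[of p]]) (use that in auto)
  have fin2': "finite (fib2 I p)" if "I \<subseteq> {0..1}" for I p
    unfolding fib2_def by (rule finite_subset[OF _ fin2[of p]]) (use that in auto)
  have cp_iff: "cp I1 I2 \<longleftrightarrow> is_interval I1 \<and> is_interval I2 \<and> I1 \<subseteq> {0..1} \<and> I2 \<subseteq> {0..1} \<and>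
      x \<in> I1 \<and> y \<in> I2 \<and> (\<forall>p. card (fib1 I1 p) = card (fib2 I2 p))" for I1 I2
    using ex_bij_betw_over_iff[of I1 \<gamma>1 I2 \<gamma>2] fin1'[of I1] fin2'[of I2]
    unfolding cp_def common_part_def fib1_def fib2_def by blast
  \<comment> \<open>A pair of intervals becomes one subset of a disjoint sum, so that componentwise
    inclusion is plain inclusion and Zorn's lemma for sets applies.\<close>
  define \<A> :: "(real + real) set set" where "\<A> = {M. cp (Inl -` M) (Inr -` M)}"
  have "\<exists>M\<in>\<A>. \<forall>X\<in>\<A>. M \<subseteq> X \<longrightarrow> X = M"
  proof (rule subset_Zorn_nonempty)
    have "cp {x} {y}"
      unfolding cp_def common_part_def using xy
      by (auto simp: is_interval_1 intro!: exI[of _ "\<lambda>_. y"])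
    moreover have "Inl -` {Inl x, Inr y} = {x}" "Inr -` {Inl x, Inr y} = {y}" by auto
    ultimately have "{Inl x, Inr y} \<in> \<A>" by (simp add: \<A>_def)
    then show "\<A> \<noteq> {}" by blast
  next
    fix \<C> assume \<C>: "\<C> \<noteq> {}" "subset.chain \<A> \<C>"
    have cp: "cp (Inl -` M) (Inr -` M)" if "M \<in> \<C>" for M
      using \<C> that by (auto simp: \<A>_def subset.chain_def)
    have total: "M \<subseteq> M' \<or> M' \<subseteq> M" if "M \<in> \<C>" "M' \<in> \<C>" for M M'
      using \<C>(2) that by (auto simp: subset_chain_def)
    have sub: "Inl -` \<Union>\<C> \<subseteq> {0..1}" "Inr -` \<Union>\<C> \<subseteq> {0..1}"
      using cp by (auto simp: cp_iff subset_iff)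
    have "is_interval (Inl -` \<Union>\<C>)"
      unfolding is_interval_1
    proof (intro ballI allI impI)
      fix a b t assume ab: "a \<in> Inl -` \<Union>\<C>" "b \<in> Inl -` \<Union>\<C>" and t: "a \<le> t \<and> t \<le> b"
      then obtain Ma Mb where "Ma \<in> \<C>" "a \<in> Inl -` Ma" "Mb \<in> \<C>" "b \<in> Inl -` Mb" by blast
      then obtain M where M: "M \<in> \<C>" "a \<in> Inl -` M" "b \<in> Inl -` M"
        using total[of Ma Mb] by blast
      then have "is_interval (Inl -` M)" using cp by (simp add: cp_iff)
      then have "t \<in> Inl -` M" using M t unfolding is_interval_1 by blast
      then show "t \<in> Inl -` \<Union>\<C>" using M by blast
    qed
    moreover have "is_interval (Inr -` \<Union>\<C>)"
      unfolding is_interval_1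
    proof (intro ballI allI impI)
      fix a b t assume ab: "a \<in> Inr -` \<Union>\<C>" "b \<in> Inr -` \<Union>\<C>" and t: "a \<le> t \<and> t \<le> b"
      then obtain Ma Mb where "Ma \<in> \<C>" "a \<in> Inr -` Ma" "Mb \<in> \<C>" "b \<in> Inr -` Mb" by blast
      then obtain M where M: "M \<in> \<C>" "a \<in> Inr -` M" "b \<in> Inr -` M"
        using total[of Ma Mb] by blast
      then have "is_interval (Inr -` M)" using cp by (simp add: cp_iff)
      then have "t \<in> Inr -` M" using M t unfolding is_interval_1 by blast
      then show "t \<in> Inr -` \<Union>\<C>" using M by blast
    qed
    moreover have "card (fib1 (Inl -` \<Union>\<C>) p) = card (fib2 (Inr -` \<Union>\<C>) p)" for p
    proof -
      \<comment> \<open>Both fibres over \<open>p\<close> are finite, so a single member of the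
        chain already contains them, and the counts agree there.\<close>
      let ?S = "Inl ` fib1 (Inl -` \<Union>\<C>) p \<union> Inr ` fib2 (Inr -` \<Union>\<C>) p"
      have "finite ?S" "?S \<subseteq> \<Union>\<C>"
        using fin1'[OF sub(1)] fin2'[OF sub(2)] by (auto simp: fib1_def fib2_def)
      then obtain M where M: "M \<in> \<C>" "?S \<subseteq> M"
        using finite_subset_Union_chain \<C> by metis
      then have "fib1 (Inl -` \<Union>\<C>) p = fib1 (Inl -` M) p" "fib2 (Inr -` \<Union>\<C>) p = fib2 (Inr -` M) p"
        unfolding fib1_def fib2_def by blast+
      then show ?thesis using cp[OF M(1)] by (simp add: cp_iff)
    qed
    moreover have "x \<in> Inl -` \<Union>\<C>" "y \<in> Inr -` \<Union>\<C>"
      using \<C>(1) cp unfolding cp_def by blast+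
    ultimately show "\<Union>\<C> \<in> \<A>" using sub by (simp add: \<A>_def cp_iff)
  qed
  then obtain M where M: "cp (Inl -` M) (Inr -` M)"
    and max: "\<And>X. cp (Inl -` X) (Inr -` X) \<Longrightarrow> M \<subseteq> X \<Longrightarrow> X = M"
    by (auto simp: \<A>_def)
  obtain \<iota> where \<iota>: "common_part \<gamma>1 \<gamma>2 (Inl -` M) (Inr -` M) \<iota>"
    using M by (auto simp: cp_def)
  have "is_meet \<gamma>1 \<gamma>2 (Inl -` M) (Inr -` M) \<iota>"
    unfolding is_meet_def
  proof (intro conjI allI impI \<iota>)
    fix J1 J2 \<kappa>
    assume J: "common_part \<gamma>1 \<gamma>2 J1 J2 \<kappa> \<and> Inl -` M \<subseteq> J1 \<and> Inr -` M \<subseteq> J2"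
    have J12: "Inl -` (J1 <+> J2) = J1" "Inr -` (J1 <+> J2) = J2" by auto
    have "M \<subseteq> J1 <+> J2"
    proof
      fix z assume "z \<in> M"
      then show "z \<in> J1 <+> J2" using J by (cases z) auto
    qed
    moreover have "cp J1 J2" using J M by (auto simp: cp_def)
    ultimately have "J1 <+> J2 = M" using max[of "J1 <+> J2"] J12 by simp
    then show "J1 = Inl -` M" "J2 = Inr -` M" using J12 by auto
  qed
  with M show thesis using that by (auto simp: cp_def)
qed

text \<open>No common part contains \<open>s1\<close> or \<open>s2\<close>, because the value there
  is missed by the other curve. So the intervals of a meet stay strictly on one side of
  \<open>s1\<close> and of \<open>s2\<close>. Each of the four combinations of sides contains a
  meet, and meets for different combinations are distinct.\<close>

lemma four_meets_of_separating_points: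
  assumes fin1: "\<And>p. finite {t \<in> {0..1}. \<gamma>1 t = p}" and fin2: "\<And>p. finite {t \<in> {0..1}. \<gamma>2 t = p}"
    and s: "s1 \<in> {0..1}" "s2 \<in> {0..1}"
    and off: "\<gamma>1 s1 \<notin> \<gamma>2 ` {0..1}" "\<gamma>2 s2 \<notin> \<gamma>1 ` {0..1}"
    and cross: "\<And>A B. A \<in> {{0..s1}, {s1..1}} \<Longrightarrow> B \<in> {{0..s2}, {s2..1}} \<Longrightarrow> \<gamma>1 ` A \<inter> \<gamma>2 ` B \<noteq> {}"
  shows "meet_at_least 4 \<gamma>1 \<gamma>2"
proof -
  \<comment> \<open>The closed halves locate the common points; the open sides, disjoint for
    different Booleans, will contain the intervals of the meets.\<close>
  define half where "half s i = (if i then {0..s} else {s..1})" for s :: real and i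
  define side where "side s i = (if i then {..<s} else {s<..})" for s :: real and i
  have "\<exists>I. (\<exists>\<iota>. is_meet \<gamma>1 \<gamma>2 (fst I) (snd I) \<iota>) \<and> fst I \<noteq> {} \<and> fst I \<subseteq> side s1 i \<and>
      snd I \<noteq> {} \<and> snd I \<subseteq> side s2 j" for i j
  proof -
    have "\<gamma>1 ` half s1 i \<inter> \<gamma>2 ` half s2 j \<noteq> {}"
      by (rule cross) (auto simp: half_def)
    then obtain x y where xy: "x \<in> half s1 i" "y \<in> half s2 j" "\<gamma>1 x = \<gamma>2 y"
      by blast
    then have xy01: "x \<in> {0..1}" "y \<in> {0..1}" using s by (auto simp: half_def split: if_splits)
    obtain I1 I2 \<iota> where m: "is_meet \<gamma>1 \<gamma>2 I1 I2 \<iota>" "x \<in> I1" "y \<in> I2"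
      using meet_through_common_point[OF fin1 fin2 xy01 xy(3)] .
    then have I: "is_interval I1" "is_interval I2" "I1 \<subseteq> {0..1}" "I2 \<subseteq> {0..1}"
        "\<iota> ` I1 = I2" "\<And>t. t \<in> I1 \<Longrightarrow> \<gamma>1 t = \<gamma>2 (\<iota> t)"
      by (auto simp: is_meet_def common_part_def bij_betw_def)
    have "s1 \<notin> I1"
    proof
      assume "s1 \<in> I1"
      then have "\<gamma>1 s1 = \<gamma>2 (\<iota> s1)" "\<iota> s1 \<in> {0..1}" using I by auto
      then show False using off(1) by blast
    qed
    moreover have "s2 \<notin> I2"
    proof
      assume "s2 \<in> I2"
      then obtain t where "t \<in> I1" "s2 = \<iota> t" using I(5) by blast
      then have "\<gamma>2 s2 = \<gamma>1 t" "t \<in> {0..1}" using I by auto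
      then show False using off(2) by blast
    qed
    moreover have "I \<subseteq> side s i'" if "is_interval I" "s \<notin> I" "x \<in> I" "x \<in> half s i'" for I s x i'
    proof
      fix t assume "t \<in> I"
      then have "\<not> (x \<le> s \<and> s \<le> t)" "\<not> (t \<le> s \<and> s \<le> x)"
        using that unfolding is_interval_1 by blast+
      then show "t \<in> side s i'"
        using \<open>x \<in> half s i'\<close> by (auto simp: side_def half_def split: if_splits)
    qed
    ultimately have "I1 \<subseteq> side s1 i" "I2 \<subseteq> side s2 j"
      using I(1,2) m xy by blast+
    then show ?thesis using m by (intro exI[of _ "(I1, I2)"]) auto
  qed
  then obtain M where meet: "\<And>i j. \<exists>\<iota>. is_meet \<gamma>1 \<gamma>2 (fst (M i j)) (snd (M i j)) \<iota>"
    and ne: "\<And>i j. fst (M i j) \<noteq> {}" "\<And>i j. snd (M i j) \<noteq> {}"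
    and sides: "\<And>i j. fst (M i j) \<subseteq> side s1 i" "\<And>i j. snd (M i j) \<subseteq> side s2 j"
    by metis
  have side_disj: "i = i'" if A: "A \<noteq> {}" "A \<subseteq> side s i" "A \<subseteq> side s i'" for A s i i'
  proof -
    obtain x where "x \<in> side s i" "x \<in> side s i'" using A by blast
    then show ?thesis by (auto simp: side_def split: if_splits)
  qed
  have inj: "inj (\<lambda>(i, j). M i j)"
    by (rule injI) (use side_disj ne sides in \<open>auto; metis\<close>)
  show ?thesis
    unfolding meet_at_least_def
  proof (intro exI conjI)
    show "finite (range (\<lambda>(i, j). M i j))" by simp
    show "card (range (\<lambda>(i, j). M i j)) = 4"
      using inj by (simp add: card_image card_UNIV_bool UNIV_Times_UNIV[symmetric] del: UNIV_Times_UNIV)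
    show "\<forall>(I1, I2)\<in>range (\<lambda>(i, j). M i j). \<exists>\<iota>. is_meet \<gamma>1 \<gamma>2 I1 I2 \<iota>"
      using meet by (auto split: prod.splits) (metis fst_conv snd_conv)+
  qed
qed

text \<open>The curve of a geodesic can cross itself, but as a concatenation of finitely many arcs
  it has finite fibres, as \<open>meet_through_common_point\<close> requires.\<close>

lemma finite_fibres_joinpaths:
  assumes "\<And>p. finite {t \<in> {0..1}. f t = p}" "\<And>p. finite {t \<in> {0..1}. g t = p}"
  shows "finite {t \<in> {0..1}. (f +++ g) t = p}"
proof (rule finite_subset)
  show "{t \<in> {0..1}. (f +++ g) t = p} \<subseteq>
      (\<lambda>t. t / 2) ` {t \<in> {0..1}. f t = p} \<union> (\<lambda>t. (t + 1) / 2) ` {t \<in> {0..1}. g t = p}"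
  proof
    fix t assume t: "t \<in> {t \<in> {0..1}. (f +++ g) t = p}"
    show "t \<in> (\<lambda>t. t / 2) ` {t \<in> {0..1}. f t = p} \<union> (\<lambda>t. (t + 1) / 2) ` {t \<in> {0..1}. g t = p}"
    proof (cases "t \<le> 1 / 2")
      case True
      with t have "2 * t \<in> {t \<in> {0..1}. f t = p}" by (simp add: joinpaths_def)
      then have "(2 * t) / 2 \<in> (\<lambda>t. t / 2) ` {t \<in> {0..1}. f t = p}" by (rule imageI)
      then show ?thesis by simp
    next
      case False
      with t have "2 * t - 1 \<in> {t \<in> {0..1}. g t = p}" by (simp add: joinpaths_def)
      then have "((2 * t - 1) + 1) / 2 \<in> (\<lambda>t. (t + 1) / 2) ` {t \<in> {0..1}. g t = p}" by (rule imageI)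
      then show ?thesis by simp
    qed
  qed
qed (use assms in auto)

lemma finite_fibres_arc:
  assumes "arc f"
  shows "finite {t \<in> {0..1}. f t = p}"
proof -
  have "f -` {p} \<inter> {0..1} = {t \<in> {0..1}. f t = p}" by auto
  then show ?thesis
    using finite_vimage_IntI[of "{p}" f "{0..1}"] assms by (simp add: arc_def)
qed

lemma joinpaths_fst: "t \<le> 1 \<Longrightarrow> (f +++ g) (t / 2) = f t"
  by (simp add: joinpaths_def)

lemma joinpaths_snd: "pathfinish f = pathstart g \<Longrightarrow> 0 \<le> t \<Longrightarrow> (f +++ g) ((t + 1) / 2) = g t"
  by (cases "t = 0") (auto simp: joinpaths_def pathfinish_def pathstart_def field_simps)

text \<open>Since \<open>+++\<close> associates to the right, the four pieces occupy the parameter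
  intervals with ends 0, 1/2, 3/4, 7/8 and 1. The middle vertex of the path therefore sits at
  3/4.\<close>

lemma join4_halves:
  assumes "pathfinish f = pathstart g" "pathfinish g = pathstart h" "pathfinish h = pathstart k"
  shows "path_image f \<union> path_image g \<subseteq> (f +++ g +++ h +++ k) ` {0..3/4}"
    and "path_image h \<union> path_image k \<subseteq> (f +++ g +++ h +++ k) ` {3/4..1}"
    and "(f +++ g +++ h +++ k) (3/4) = pathfinish g"
proof -
  let ?j = "f +++ g +++ h +++ k"
  have f: "?j (t / 2) = f t" if "t \<in> {0..1}" for t
    using that by (simp add: joinpaths_fst)
  have g: "?j ((t / 2 + 1) / 2) = g t" if "t \<in> {0..1}" for t
  proof -
    have "?j ((t / 2 + 1) / 2) = (g +++ h +++ k) (t / 2)"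
      using that assms by (intro joinpaths_snd) auto
    then show ?thesis using that by (simp add: joinpaths_fst)
  qed
  have h: "?j (((t / 2 + 1) / 2 + 1) / 2) = h t" if "t \<in> {0..1}" for t
  proof -
    have "?j (((t / 2 + 1) / 2 + 1) / 2) = (g +++ h +++ k) ((t / 2 + 1) / 2)"
      using that assms by (intro joinpaths_snd) auto
    also have "\<dots> = (h +++ k) (t / 2)"
      using that assms by (intro joinpaths_snd) auto
    finally show ?thesis using that by (simp add: joinpaths_fst)
  qed
  have k: "?j ((((t + 1) / 2 + 1) / 2 + 1) / 2) = k t" if "t \<in> {0..1}" for t
  proof -
    have "?j ((((t + 1) / 2 + 1) / 2 + 1) / 2) = (g +++ h +++ k) (((t + 1) / 2 + 1) / 2)"
      using that assms by (intro joinpaths_snd) auto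
    also have "\<dots> = (h +++ k) ((t + 1) / 2)"
      using that assms by (intro joinpaths_snd) auto
    finally show ?thesis using that assms by (simp add: joinpaths_snd)
  qed
  show "path_image f \<union> path_image g \<subseteq> ?j ` {0..3/4}"
    unfolding path_image_def by (auto simp flip: f g intro!: imageI)
  show "path_image h \<union> path_image k \<subseteq> ?j ` {3/4..1}"
    unfolding path_image_def by (auto simp flip: h k intro!: imageI)
  show "?j (3/4) = pathfinish g"
    using g[of 1] by (simp add: pathfinish_def)
qed

subsection \<open>A homogeneous pattern\<close>

lemma sorted_list_of_set_map_upt:
  fixes h :: "nat \<Rightarrow> nat"
  assumes "strict_mono_on {..<n} h"
  shows "sorted_list_of_set (h ` {..<n}) = map h [0..<n]"
proof -
  have "sorted_wrt (<) (map h [0..<n])"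
    using assms by (auto simp: sorted_wrt_map sorted_wrt_iff_nth_less strict_mono_on_def)
  then have "sorted (map h [0..<n])" "distinct (map h [0..<n])"
    by (simp_all add: strict_sorted_iff)
  then have "sorted_list_of_set (set (map h [0..<n])) = map h [0..<n]"
    by (rule sorted_list_of_set.idem_if_sorted_distinct)
  then show ?thesis by (simp add: lessThan_atLeast0)
qed

text \<open>On a homogeneous set the truth of \<open>R\<close> depends only on the relative order of
  its arguments, for one fixed pattern, so \<open>c\<close> and \<open>d\<close> can each be
  replaced by a neighbour in that order. The bound \<open>N\<close> is chosen before
  \<open>R\<close>, so it serves all drawings at once.\<close>

lemma ramsey_two_by_two:
  obtains N :: nat where "\<And>n (R :: nat \<Rightarrow> nat \<Rightarrow> nat \<Rightarrow> nat \<Rightarrow> bool). n \<ge> N \<Longrightarrow>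
    (\<And>X. X \<subseteq> {..<n} \<Longrightarrow> card X = 5 \<Longrightarrow>
        \<exists>a\<in>X. \<exists>c\<in>X. \<exists>b\<in>X. \<exists>d\<in>X. distinct [a, c, b, d] \<and> R a c b d) \<Longrightarrow>
    \<exists>a c c' b d d'. {a, c, c', b, d, d'} \<subseteq> {..<n} \<and> distinct [a, c, c', b, d, d'] \<and>
        R a c b d \<and> R a c b d' \<and> R a c' b d \<and> R a c' b d'"
proof -
  have "finite ({..<4} \<times> {..<4} \<times> {..<4} \<times> {..<4} :: (nat \<times> nat \<times> nat \<times> nat) set)" by simp
  then obtain pats :: "(nat \<times> nat \<times> nat \<times> nat) list"
    where pats: "set pats = {..<4} \<times> {..<4} \<times> {..<4} \<times> {..<4}"
    using finite_list by blast
  let ?m = "length pats"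
  \<comment> \<open>One colour for each candidate pattern, and colour \<open>?m\<close> for 4-sets
    without any. The size 8 leaves two positions for each of the four slots.\<close>
  obtain N :: nat where N: "partn_lst {..<N} (replicate (Suc ?m) 8) 4"
    using ramsey_full by blast
  show thesis
  proof (rule that[of N])
    fix n and R :: "nat \<Rightarrow> nat \<Rightarrow> nat \<Rightarrow> nat \<Rightarrow> bool"
    assume n: "n \<ge> N"
      and five: "\<And>X. X \<subseteq> {..<n} \<Longrightarrow> card X = 5 \<Longrightarrow>
        \<exists>a\<in>X. \<exists>c\<in>X. \<exists>b\<in>X. \<exists>d\<in>X. distinct [a, c, b, d] \<and> R a c b d"
    \<comment> \<open>Pattern \<open>q\<close> lists the ranks in \<open>X\<close>, counted from 0
      in increasing order, of the four arguments of \<open>R\<close>.\<close>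
    define good where "good q X \<longleftrightarrow> (case pats ! q of (i, j, k, l) \<Rightarrow>
      let xs = sorted_list_of_set X in distinct [i, j, k, l] \<and> R (xs ! i) (xs ! j) (xs ! k) (xs ! l))" for q X
    define f where "f X = (if \<exists>q<?m. good q X then LEAST q. q < ?m \<and> good q X else ?m)" for X
    have f_good: "f X < ?m \<and> good (f X) X" if "\<exists>q<?m. good q X" for X
      using that LeastI_ex[of "\<lambda>q. q < ?m \<and> good q X"] by (simp add: f_def)
    have "f X \<le> ?m" for X
      using f_good[of X] by (cases "\<exists>q<?m. good q X") (auto simp: f_def)
    then have "f \<in> nsets {..<N} 4 \<rightarrow> {..<length (replicate (Suc ?m) (8::nat))}"
      by (auto simp: less_Suc_eq_le)
    then obtain q where q: "q < Suc ?m" "monochromatic {..<N} (replicate (Suc ?m) 8 ! q) 4 f q"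
      using N unfolding partn_lst_def by fastforce
    then obtain H where H: "H \<subseteq> {..<N}" "finite H" "card H = 8" "f ` nsets H 4 \<subseteq> {q}"
      by (auto simp: monochromatic_def nsets_def simp del: replicate_Suc)
    \<comment> \<open>Five elements of \<open>H\<close> already contain a 4-set with a pattern, so
      the common colour cannot be the default \<open>?m\<close>.\<close>
    have "5 \<le> card H" using H(3) by simp
    then obtain X where X: "X \<subseteq> H" "card X = 5"
      by (rule obtain_subset_with_card_n)
    have "X \<subseteq> {..<n}" using X H n by auto
    then obtain a c b d where abcd: "{a, c, b, d} \<subseteq> X" "distinct [a, c, b, d]" "R a c b d"
      using five[OF _ X(2)] by blast
    define Y where "Y = {a, c, b, d}"
    have Y: "Y \<in> nsets H 4"
      using abcd X by (auto simp: Y_def nsets_def)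
    define xs where "xs = sorted_list_of_set Y"
    have xs: "set xs = {a, c, b, d}" "length xs = 4"
      using Y by (simp_all add: xs_def nsets_def flip: Y_def)
    obtain i j k l where ijkl: "i < 4" "j < 4" "k < 4" "l < 4" "xs ! i = a" "xs ! j = c" "xs ! k = b" "xs ! l = d"
      using in_set_conv_nth[of a xs] in_set_conv_nth[of c xs] in_set_conv_nth[of b xs]
        in_set_conv_nth[of d xs] xs by auto
    then have "(i, j, k, l) \<in> set pats" by (simp add: pats)
    then obtain q' where "q' < ?m" "pats ! q' = (i, j, k, l)" by (metis in_set_conv_nth)
    moreover from this have "good q' Y"
      using abcd ijkl by (auto simp: good_def Let_def simp flip: xs_def)
    ultimately have "f Y < ?m" using f_good by blast
    then have "q < ?m" using H(4) Y by auto
    have good: "good q Y" if "Y \<in> nsets H 4" for Y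
    proof -
      have "f Y = q" using H(4) that by auto
      then show ?thesis using f_good[of Y] \<open>q < ?m\<close> by (cases "\<exists>q<?m. good q Y") (auto simp: f_def)
    qed
    obtain i j k l where pat: "pats ! q = (i, j, k, l)" by (cases "pats ! q") auto
    then have lt4: "{i, j, k, l} \<subseteq> {..<4}"
      using nth_mem[OF \<open>q < ?m\<close>] by (auto simp: pats)
    have dist: "distinct [i, j, k, l]"
      using good[OF Y] pat by (auto simp: good_def Let_def)
    define h where "h = (!) (sorted_list_of_set H)"
    have h: "strict_mono_on {..<8} h" "h ` {..<8} = H"
    proof -
      have "sorted_wrt (<) (sorted_list_of_set H)" "length (sorted_list_of_set H) = 8"
        using H by simp_all
      then show "strict_mono_on {..<8} h"
        by (auto simp: h_def strict_mono_on_def sorted_wrt_iff_nth_less)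
      show "h ` {..<8} = H"
        using H nth_image[of 8 "sorted_list_of_set H"] by (simp add: h_def lessThan_atLeast0)
    qed
    have R: "R (h (e i)) (h (e j)) (h (e k)) (h (e l))"
      if e: "strict_mono_on {..<4} e" "e ` {..<4} \<subseteq> {..<8}" for e :: "nat \<Rightarrow> nat"
    proof -
      have mono: "strict_mono_on {..<4} (h \<circ> e)"
        using h(1) e by (auto simp: strict_mono_on_def image_subset_iff)
      have "card ((h \<circ> e) ` {..<4}) = 4"
        using card_image[OF strict_mono_on_imp_inj_on[OF mono]] by simp
      then have "(h \<circ> e) ` {..<4} \<in> nsets H 4"
        using h(2) e(2) by (auto simp: nsets_def)
      from good[OF this, unfolded good_def sorted_list_of_set_map_upt[OF mono]] pat lt4
      show ?thesis by (simp add: Let_def)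
    qed
    \<comment> \<open>Slots \<open>j\<close> and \<open>l\<close> of the pattern are doubled; \<open>e s t\<close> selects one copy of each.\<close>
    define e where "e s t m = 2 * m + (if m = j then s else if m = l then t else 0)" for s t m :: nat
    have Re: "R (h (2 * i)) (h (2 * j + s)) (h (2 * k)) (h (2 * l + t))" if "s \<le> 1" "t \<le> 1" for s t
    proof -
      \<comment> \<open>A shift by at most 1 keeps the positions \<open>2 * m\<close> in increasing
        order, so every slot keeps its rank whichever copies are selected.\<close>
      have "strict_mono_on {..<4} (e s t)" "e s t ` {..<4} \<subseteq> {..<8}"
        using that by (auto simp: strict_mono_on_def e_def)
      from R[OF this] show ?thesis using dist by (simp add: e_def)
    qed
    let ?xs = "[2 * i, 2 * j, 2 * j + 1, 2 * k, 2 * l, 2 * l + 1]"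
    have xs8: "set ?xs \<subseteq> {..<8}" using lt4 by auto
    have "2 * x + 1 \<noteq> 2 * y" for x y :: nat by presburger
    then have "distinct ?xs" using dist by auto
    then have "distinct (map h ?xs)"
      using inj_on_subset[OF strict_mono_on_imp_inj_on[OF h(1)] xs8] by (simp only: distinct_map)
    moreover have "H \<subseteq> {..<n}" using H(1) n by auto
    then have "h ` set ?xs \<subseteq> {..<n}"
      using image_mono[OF xs8, of h] unfolding h(2) by (rule order_trans[rotated])
    ultimately show "\<exists>a c c' b d d'. {a, c, c', b, d, d'} \<subseteq> {..<n} \<and> distinct [a, c, c', b, d, d'] \<and>
        R a c b d \<and> R a c b d' \<and> R a c' b d \<and> R a c' b d'"
      using Re[of 0 0] Re[of 0 1] Re[of 1 0] Re[of 1 1]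
      by - (rule exI[of _ "h (2 * i)"], rule exI[of _ "h (2 * j)"], rule exI[of _ "h (2 * j + 1)"],
          rule exI[of _ "h (2 * k)"], rule exI[of _ "h (2 * l)"], rule exI[of _ "h (2 * l + 1)"], simp)
  qed
qed

subsection \<open>Drawings\<close>

text \<open>
  Contrary to the name, the middle edge of the subdivided edge \<open>ac\<close> belongs to both halves, so
  that the two halves cover the whole edge.
\<close>

definition half_edge :: "(nat \<Rightarrow> nat \<Rightarrow> real \<Rightarrow> real^2) \<Rightarrow> nat \<Rightarrow> nat \<Rightarrow> (real^2) set" where
  "half_edge crv a c = path_image (crv (prod_encode (a, a)) (prod_encode (a, c))) \<union>
     path_image (crv (prod_encode (a, c)) (prod_encode (c, a)))"

context
  fixes n :: nat and pos :: "nat \<Rightarrow> real^2" and crv :: "nat \<Rightarrow> nat \<Rightarrow> real \<Rightarrow> real^2"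
  assumes drawing: "drawing (sub_complete n) pos crv"
begin

lemma edge_curve:
  assumes "{u, v} \<in> sub_edges n"
  shows "arc (crv u v)" "path (crv u v)" "pathstart (crv u v) = pos u" "pathfinish (crv u v) = pos v"
    and "path_image (crv v u) = path_image (crv u v)"
    and "\<And>w. w \<in> sub_verts n \<Longrightarrow> w \<noteq> u \<Longrightarrow> w \<noteq> v \<Longrightarrow> pos w \<notin> path_image (crv u v)"
  using drawing assms by (auto simp: drawing_def arc_imp_path)

text \<open>Joining the three arcs of each subdivided edge draws the complete graph on
  \<open>X\<close>. Each joined curve is covered by its two half-edges, so a common point of
  independent edges lies on a half-edge of each, after swapping ends if necessary. This is the
  hypothesis on 5-sets in \<open>ramsey_two_by_two\<close>.\<close>

lemma independent_half_edges_meet: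
  assumes "X \<subseteq> {..<n}" "card X = 5"
  shows "\<exists>a\<in>X. \<exists>c\<in>X. \<exists>b\<in>X. \<exists>d\<in>X. distinct [a, c, b, d] \<and> half_edge crv a c \<inter> half_edge crv b d \<noteq> {}"
proof -
  have "finite X" using assms by (metis card.infinite zero_neq_numeral)
  then obtain h where h: "bij_betw h {..<5::nat} X"
    using ex_bij_betw_nat_finite[of X] assms by (auto simp: lessThan_atLeast0)
  define \<phi> :: "real^2 \<Rightarrow> complex" where "\<phi> v = Complex (v $ 1) (v $ 2)" for v
  have \<phi>_cont: "continuous_on A \<phi>" for A
    unfolding \<phi>_def Complex_eq by (intro continuous_intros)
  have \<phi>_inj: "\<phi> v = \<phi> w \<longleftrightarrow> v = w" for v w
    by (auto simp: \<phi>_def vec_eq_iff forall_2)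
  define E where "E a b = crv (prod_encode (a, a)) (prod_encode (a, b)) +++
      crv (prod_encode (a, b)) (prod_encode (b, a)) +++ crv (prod_encode (b, a)) (prod_encode (b, b))" for a b
  have E: "path (E a b)" "pathstart (E a b) = pos (prod_encode (a, a))"
      "pathfinish (E a b) = pos (prod_encode (b, b))"
      "path_image (E a b) = half_edge crv a b \<union> half_edge crv b a"
    if "a < n" "b < n" "a \<noteq> b" for a b
  proof -
    have e: "{prod_encode (a, a), prod_encode (a, b)} \<in> sub_edges n"
      "{prod_encode (a, b), prod_encode (b, a)} \<in> sub_edges n"
      "{prod_encode (b, a), prod_encode (b, b)} \<in> sub_edges n" using that by auto
    show "path (E a b)" "pathstart (E a b) = pos (prod_encode (a, a))"
      "pathfinish (E a b) = pos (prod_encode (b, b))"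
      using edge_curve[OF e(1)] edge_curve[OF e(2)] edge_curve[OF e(3)]
      by (simp_all add: E_def)
    show "path_image (E a b) = half_edge crv a b \<union> half_edge crv b a"
      using edge_curve[OF e(1)] edge_curve[OF e(2)] edge_curve[OF e(3)]
      by (auto simp: E_def half_edge_def path_image_join)
  qed
  have hX: "h i \<in> X" "h i < n" if "i < 5" for i
    using h that assms by (auto simp: bij_betw_def)
  have h_neq: "h i \<noteq> h j" if "i < 5" "j < 5" "i \<noteq> j" for i j
    using h that by (auto simp: bij_betw_def inj_on_def)
  have "\<exists>i j k l. i < j \<and> j < 5 \<and> k < l \<and> l < 5 \<and> distinct [i, j, k, l] \<and>
      path_image (\<phi> \<circ> E (h i) (h j)) \<inter> path_image (\<phi> \<circ> E (h k) (h l)) \<noteq> {}"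
    by (rule K5_independent_edges_meet[of "\<lambda>i j. \<phi> \<circ> E (h i) (h j)" "\<lambda>i. \<phi> (pos (prod_encode (h i, h i)))"])
      (use hX h_neq E in \<open>auto simp: path_continuous_image[OF _ \<phi>_cont] pathstart_compose pathfinish_compose\<close>)
  then obtain i j k l where "i < j" "j < 5" "k < l" "l < 5" and dist: "distinct [i, j, k, l]"
    and meet: "path_image (\<phi> \<circ> E (h i) (h j)) \<inter> path_image (\<phi> \<circ> E (h k) (h l)) \<noteq> {}"
    by blast
  then have lt: "i < 5" "j < 5" "k < 5" "l < 5" by simp_all
  have "path_image (E (h i) (h j)) \<inter> path_image (E (h k) (h l)) \<noteq> {}"
    using meet by (auto simp: path_image_compose \<phi>_inj)
  then have "(half_edge crv (h i) (h j) \<union> half_edge crv (h j) (h i)) \<inter>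
      (half_edge crv (h k) (h l) \<union> half_edge crv (h l) (h k)) \<noteq> {}"
    using E(4) hX h_neq lt dist by simp
  then obtain a c b d where "half_edge crv a c \<inter> half_edge crv b d \<noteq> {}"
    and "(a, c) \<in> {(h i, h j), (h j, h i)}" "(b, d) \<in> {(h k, h l), (h l, h k)}"
    by blast
  moreover have "distinct [h i, h j, h k, h l]" using h_neq lt dist by simp
  moreover have "{h i, h j, h k, h l} \<subseteq> X" using hX lt by simp
  ultimately show ?thesis
    by - (rule bexI[of _ a], rule bexI[of _ c], rule bexI[of _ b], rule bexI[of _ d], auto)
qed

text \<open>Prepares \<open>four_meets_of_separating_points\<close> with the centre
  \<open>(a, a)\<close> as separating point. The last claim, applied to the centre of the other
  star, holds because a drawing keeps every vertex off the edges that do not end in it.\<close>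

lemma star_path_curve:
  assumes "a < n" "c < n" "c' < n" "distinct [a, c, c']"
  defines "\<gamma> \<equiv> path_curve crv (star_path a c c')"
  shows "finite {t \<in> {0..1}. \<gamma> t = p}"
    and "\<gamma> (3/4) = pos (prod_encode (a, a))"
    and "half_edge crv a c \<subseteq> \<gamma> ` {0..3/4}" "half_edge crv a c' \<subseteq> \<gamma> ` {3/4..1}"
    and "w \<in> sub_verts n \<Longrightarrow> w \<notin> set (star_path a c c') \<Longrightarrow> pos w \<notin> \<gamma> ` {0..1}"
proof -
  have e: "{prod_encode (c, a), prod_encode (a, c)} \<in> sub_edges n"
      "{prod_encode (a, c), prod_encode (a, a)} \<in> sub_edges n"
      "{prod_encode (a, a), prod_encode (a, c')} \<in> sub_edges n"
      "{prod_encode (a, c'), prod_encode (c', a)} \<in> sub_edges n"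
    using assms by auto
  note cs = edge_curve[OF e(1)] edge_curve[OF e(2)] edge_curve[OF e(3)] edge_curve[OF e(4)]
  have \<gamma>: "\<gamma> = crv (prod_encode (c, a)) (prod_encode (a, c)) +++ crv (prod_encode (a, c)) (prod_encode (a, a)) +++
      crv (prod_encode (a, a)) (prod_encode (a, c')) +++ crv (prod_encode (a, c')) (prod_encode (c', a))"
    by (simp add: \<gamma>_def star_path_def)
  show "finite {t \<in> {0..1}. \<gamma> t = p}"
    unfolding \<gamma> using cs by (intro finite_fibres_joinpaths finite_fibres_arc)
  have he: "half_edge crv a c = path_image (crv (prod_encode (c, a)) (prod_encode (a, c))) \<union>
      path_image (crv (prod_encode (a, c)) (prod_encode (a, a)))"
    using cs by (auto simp: half_edge_def)
  show "\<gamma> (3/4) = pos (prod_encode (a, a))" "half_edge crv a c \<subseteq> \<gamma> ` {0..3/4}"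
    "half_edge crv a c' \<subseteq> \<gamma> ` {3/4..1}"
    unfolding \<gamma> he half_edge_def[of crv a c'] using cs by (simp_all only: join4_halves)
  assume "w \<in> sub_verts n" "w \<notin> set (star_path a c c')"
  then have "pos w \<notin> path_image \<gamma>"
    unfolding \<gamma> using cs by (simp add: star_path_def path_image_join)
  then show "pos w \<notin> \<gamma> ` {0..1}" by (simp add: path_image_def)
qed

lemma star_paths_meet_four_times:
  assumes "{a, c, c', b, d, d'} \<subseteq> {..<n}" "distinct [a, c, c', b, d, d']"
    and "half_edge crv a c \<inter> half_edge crv b d \<noteq> {}" "half_edge crv a c \<inter> half_edge crv b d' \<noteq> {}"
    and "half_edge crv a c' \<inter> half_edge crv b d \<noteq> {}" "half_edge crv a c' \<inter> half_edge crv b d' \<noteq> {}"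
  shows "meet_at_least 4 (path_curve crv (star_path a c c')) (path_curve crv (star_path b d d'))"
proof -
  have A: "a < n" "c < n" "c' < n" "distinct [a, c, c']" and B: "b < n" "d < n" "d' < n" "distinct [b, d, d']"
    using assms(1,2) by auto
  note P = star_path_curve[OF A] and Q = star_path_curve[OF B]
  show ?thesis
  proof (rule four_meets_of_separating_points[OF P(1) Q(1), of "3/4" "3/4"])
    show "path_curve crv (star_path a c c') (3/4) \<notin> path_curve crv (star_path b d d') ` {0..1}"
      unfolding P(2) by (rule Q(5)) (use assms(1,2) in \<open>auto simp: star_path_def\<close>)
    show "path_curve crv (star_path b d d') (3/4) \<notin> path_curve crv (star_path a c c') ` {0..1}"
      unfolding Q(2) by (rule P(5)) (use assms(1,2) in \<open>auto simp: star_path_def\<close>)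
    show "path_curve crv (star_path a c c') ` A \<inter> path_curve crv (star_path b d d') ` B \<noteq> {}"
      if "A \<in> {{0..3/4}, {3/4..1}}" "B \<in> {{0..3/4}, {3/4..1}}" for A B
      using that assms(3-6) P(3,4) Q(3,4) by blast
  qed auto
qed

end

section \<open>The infinite family\<close>

theorem theorem1:
  "\<exists>(F :: nat ugraph set) (c :: real).
     infinite F \<and> (\<forall>G\<in>F. \<forall>H\<in>F. graph_iso G H \<longrightarrow> G = H) \<and> c > 0 \<and>
     (\<forall>G\<in>F. finite_simple_graph G \<and> geodetic G \<and>
        real (card (edges G)) \<le> c * real (card (verts G))) \<and>
     (\<forall>G\<in>F. \<forall>pos crv. drawing G pos crv \<longrightarrow>
        (\<exists>u1 v1 P1 u2 v2 P2.
           u1 \<noteq> v1 \<and> shortest_path G u1 v1 P1 \<and>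
           u2 \<noteq> v2 \<and> shortest_path G u2 v2 P2 \<and>
           P1 \<noteq> P2 \<and> P1 \<noteq> rev P2 \<and>
           meet_at_least 4 (path_curve crv P1) (path_curve crv P2)))"
proof -
  obtain N :: nat where N: "\<And>n (R :: nat \<Rightarrow> nat \<Rightarrow> nat \<Rightarrow> nat \<Rightarrow> bool). n \<ge> N \<Longrightarrow>
    (\<And>X. X \<subseteq> {..<n} \<Longrightarrow> card X = 5 \<Longrightarrow>
        \<exists>a\<in>X. \<exists>c\<in>X. \<exists>b\<in>X. \<exists>d\<in>X. distinct [a, c, b, d] \<and> R a c b d) \<Longrightarrow>
    \<exists>a c c' b d d'. {a, c, c', b, d, d'} \<subseteq> {..<n} \<and> distinct [a, c, c', b, d, d'] \<and>
        R a c b d \<and> R a c b d' \<and> R a c' b d \<and> R a c' b d'"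
    using ramsey_two_by_two by blast
  have "inj sub_complete"
    by (rule injI) (metis card_sub_verts power2_eq_square power2_eq_iff_nonneg verts_sub_complete zero_le)
  then have inf: "infinite (sub_complete ` {N..})"
    by (simp add: finite_image_iff inj_on_subset infinite_Ici)
  have meet: "\<exists>u1 v1 P1 u2 v2 P2. u1 \<noteq> v1 \<and> shortest_path (sub_complete n) u1 v1 P1 \<and>
           u2 \<noteq> v2 \<and> shortest_path (sub_complete n) u2 v2 P2 \<and> P1 \<noteq> P2 \<and> P1 \<noteq> rev P2 \<and>
           meet_at_least 4 (path_curve crv P1) (path_curve crv P2)"
    if "n \<ge> N" and dr: "drawing (sub_complete n) pos crv" for n pos crv
  proof -
    obtain a c c' b d d' where *: "{a, c, c', b, d, d'} \<subseteq> {..<n}" "distinct [a, c, c', b, d, d']"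
      "half_edge crv a c \<inter> half_edge crv b d \<noteq> {}" "half_edge crv a c \<inter> half_edge crv b d' \<noteq> {}"
      "half_edge crv a c' \<inter> half_edge crv b d \<noteq> {}" "half_edge crv a c' \<inter> half_edge crv b d' \<noteq> {}"
      using N[OF \<open>n \<ge> N\<close>, of "\<lambda>a c b d. half_edge crv a c \<inter> half_edge crv b d \<noteq> {}"]
        independent_half_edges_meet[OF dr] by metis
    have "shortest_path (sub_complete n) (prod_encode (c, a)) (prod_encode (c', a)) (star_path a c c')"
      "shortest_path (sub_complete n) (prod_encode (d, b)) (prod_encode (d', b)) (star_path b d d')"
      using *(1,2) by (auto intro!: shortest_path_star_path)
    moreover have "star_path a c c' \<noteq> star_path b d d'" "star_path a c c' \<noteq> rev (star_path b d d')"
      using *(2) by (auto simp: star_path_def)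
    moreover have "prod_encode (c, a) \<noteq> prod_encode (c', a)" "prod_encode (d, b) \<noteq> prod_encode (d', b)"
      using *(2) by auto
    ultimately show ?thesis
      using star_paths_meet_four_times[OF dr *] by blast
  qed
  have sparse: "real (card (sub_edges n)) \<le> 2 * real (card (sub_verts n))" for n
    using card_sub_edges_le[of n] card_sub_verts[of n] by linarith
  show ?thesis
  \<comment> \<open>The family starts at the Ramsey bound. The constant 2 compares at most
    \<open>2 * (n * n)\<close> edges with \<open>n * n\<close> vertices.\<close>
  proof (intro exI[of _ "sub_complete ` {N..}"] exI[of _ 2] conjI)
    show "\<forall>G\<in>sub_complete ` {N..}. \<forall>H\<in>sub_complete ` {N..}. graph_iso G H \<longrightarrow> G = H"
      using graph_iso_sub_complete by blast
  qed (use inf meet sparse in \<open>auto simp: finite_simple_graph_sub_complete geodetic_sub_complete\<close>)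
qed

end
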